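(* Let $p$ be a prime, $q=p^f$ with $f\ge1$, let $k\mid q-1$, and let $A_k=\{x^k:x\in\mathbb{F}_q^\times\}\le\mathbb{F}_q^\times$ have order $t=(q-1)/k>4$. If $p^e\equiv-1\pmod t$ for some integer $e\ge1$, then $$|(A_k-a)\cap(A_k-b)|\le2\qquad(a,b\in\mathbb{F}_q,\ a\neq b).$$ In particular, $A_k$ is additively irreducible.
   Context: $A-a=\{x-a:x\in A\}$. A set $A\subseteq\mathbb{F}_q$ is additively irreducible if there are no sets $S,T\subseteq\mathbb{F}_q$ with $|S|,|T|\ge2$ and $A=S+T$, where $S+T=\{s+u:s\in S,\ u\in T\}$. *)

theory Defs
  imports Main "HOL-Library.Cardinality" "HOL-Library.Set_Algebras"
    "HOL-Computational_Algebra.Primes" "HOL-Number_Theory.Cong"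
begin

definition power_subgroup :: "nat \<Rightarrow> ('a :: {field, finite}) set" where
  "power_subgroup k = {x ^ k | x. x \<noteq> 0}"

definition translate_by_minus :: "('a :: {field, finite}) set \<Rightarrow> 'a \<Rightarrow> 'a set" where
  "translate_by_minus A a = {x - a | x. x \<in> A}"

text \<open>The sum of two sets is the Minkowski sum of HOL-Library.Set_Algebras.\<close>

definition additively_irreducible :: "('a :: {field, finite}) set \<Rightarrow> bool" where
  "additively_irreducible A \<longleftrightarrow>
     \<not> (\<exists>S T. card S \<ge> 2 \<and> card T \<ge> 2 \<and> A = S + T)"

end

(* If t divides p^e + 1, then Frobenius acts on the subgroup of order t by inversion:
   x^(p^e) = 1/x. Subtracting the two relations (y + a)^(p^e) = 1/(y + a) and
   (y + b)^(p^e) = 1/(y + b) eliminates y^(p^e), because Frobenius is additive, and leaves the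
   quadratic equation (y + a)(y + b) = (b - a)/(a - b)^(p^e) for y.
   If A = S + T, then S lies in the intersection of two translates of A by distinct elements of T,
   and conversely, so |A| <= |S| |T| <= 4 < t. *)
theory Submission
  imports Defs "HOL-Computational_Algebra.Polynomial" "HOL-Number_Theory.Residues"
begin

(* The library proves this only for the class finite_field, of which the sort {field, finite}
   is not a subclass. *)
lemma power_card_minus_one:
  fixes x :: "'a :: {field, finite}"
  assumes "x \<noteq> 0"
  shows "x ^ (CARD('a) - 1) = 1"
proof -
  \<comment> \<open>Multiplication by the unit \<open>x\<close> permutes the nonzero elements; their
    product is nonzero and cancels.\<close>
  have "(\<Prod>y\<in>UNIV - {0}. x * y) = (\<Prod>y\<in>UNIV - {0}. y)"
    by (rule prod.reindex_bij_witness[of _ "\<lambda>y. y / x" "\<lambda>y. x * y"]) (use assms in auto)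
  then have "x ^ (CARD('a) - 1) * \<Prod>(UNIV - {0 :: 'a}) = \<Prod>(UNIV - {0})"
    by (simp add: prod.distrib card_Diff_singleton)
  then show ?thesis
    by simp
qed

lemma CHAR_eq_of_CARD_eq_prime_power:
  assumes "prime p" and "CARD('a :: {field, finite}) = p ^ f"
  shows "CHAR('a) = p"
proof -
  have "prime CHAR('a)"
    by (simp add: finite_imp_CHAR_pos prime_CHAR_semidom)
  moreover have "CHAR('a) dvd p ^ f"
    using CHAR_dvd_CARD[where 'a = 'a] assms(2) by simp
  ultimately show ?thesis
    using assms(1) prime_dvd_power primes_dvd_imp_eq by blast
qed

text \<open>These are the roots of X^k - c, which has degree \<open>k\<close> and is nonzero because
  k > 0.\<close>

lemma card_nth_roots_le:
  fixes c :: "'a :: idom"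
  assumes "k > 0"
  shows "card {x. x ^ k = c} \<le> k"
proof -
  define P where "P = Polynomial.monom 1 k + [:- c:]"
  have deg: "degree P = k"
    unfolding P_def using assms
    by (simp add: degree_add_eq_left degree_monom_eq)
  then have "P \<noteq> 0"
    using assms by auto
  from card_poly_roots_bound[OF this] show ?thesis
    by (simp add: deg) (simp add: P_def poly_monom)
qed

lemma card_shifted_product_eq_le_2:
  fixes a b c :: "'a :: idom"
  shows "card {y. (y + a) * (y + b) = c} \<le> 2"
proof (cases "\<exists>y. (y + a) * (y + b) = c")
  case True
  then obtain z where z: "(z + a) * (z + b) = c" by blast
  \<comment> \<open>By Vieta the two roots of the quadratic add up to -(a + b), so one root
    \<open>z\<close> determines the other.\<close>
  have "{y. (y + a) * (y + b) = c} \<subseteq> {z, - (z + a + b)}"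
  proof
    fix y assume "y \<in> {y. (y + a) * (y + b) = c}"
    with z have "(y + a) * (y + b) - (z + a) * (z + b) = 0"
      by simp
    then have "(y - z) * (y + z + a + b) = 0"
      by (simp add: algebra_simps)
    then show "y \<in> {z, - (z + a + b)}"
      by (simp add: eq_neg_iff_add_eq_0 add.assoc del: minus_add_distrib)
  qed
  then show ?thesis
    by (rule order.trans[OF card_mono, rotated]) (auto simp: card_insert_if)
qed simp

text \<open>The fibres of x -> x^k cover the nonzero elements and have at most \<open>k\<close>
  members each. This lower bound on the order is what turns t > 4 into
  \<open>card A > 4\<close>.\<close>

lemma card_power_subgroup_ge:
  assumes "k > 0"
  shows "(CARD('a) - 1) div k \<le> card (power_subgroup k :: 'a :: {field, finite} set)"
proof -
  let ?A = "power_subgroup k :: 'a set"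
  have "CARD('a) - 1 = card (UNIV - {0 :: 'a})"
    by (simp add: card_Diff_singleton)
  also have "\<dots> \<le> card (\<Union>c\<in>?A. {x. x ^ k = c})"
    by (intro card_mono) (auto simp: power_subgroup_def)
  also have "\<dots> \<le> (\<Sum>c\<in>?A. card {x. x ^ k = c})"
    by (intro card_UN_le) simp
  also have "\<dots> \<le> card ?A * k"
    by (rule sum_bounded_above[where K = k, simplified]) (rule card_nth_roots_le[OF assms])
  finally show ?thesis
    using assms by (metis div_le_mono div_mult_self_is_m)
qed

lemma mem_translate_by_minus_iff: "y \<in> translate_by_minus A a \<longleftrightarrow> y + a \<in> A"
  unfolding translate_by_minus_def by (auto intro: exI[of _ "y + a"])

lemma card_Int_translates_le_2:
  fixes A :: "'a :: {field, finite} set"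
  assumes "prime p" and "CHAR('a) = p"
    and inv: "\<And>x. x \<in> A \<Longrightarrow> x ^ (p ^ e) * x = 1"
    and "a \<noteq> b"
  shows "card (translate_by_minus A a \<inter> translate_by_minus A b) \<le> 2"
proof -
  let ?P = "p ^ e"
  have frob: "(x + y) ^ ?P = x ^ ?P + y ^ ?P" for x y :: 'a
    by (rule freshmans_dream') (use assms in auto)
  define d where "d = (b - a) / (a ^ ?P - b ^ ?P)"
  \<comment> \<open>Additivity gives a^P - b^P = (a - b)^P, so distinct \<open>a\<close> and
    \<open>b\<close> have distinct Frobenius images and the denominator of \<open>d\<close> is
    nonzero.\<close>
  have "a ^ ?P = (a - b) ^ ?P + b ^ ?P"
    using frob[of "a - b" b] by simp
  then have nz: "a ^ ?P - b ^ ?P \<noteq> 0"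
    using \<open>a \<noteq> b\<close> by simp
  have "translate_by_minus A a \<inter> translate_by_minus A b \<subseteq> {y. (y + a) * (y + b) = d}"
  proof
    fix y assume "y \<in> translate_by_minus A a \<inter> translate_by_minus A b"
    then have "y + a \<in> A" "y + b \<in> A"
      by (auto simp: mem_translate_by_minus_iff)
    then have 1: "(y ^ ?P + a ^ ?P) * (y + a) = 1" and 2: "(y ^ ?P + b ^ ?P) * (y + b) = 1"
      using inv frob by metis+
    \<comment> \<open>Weighting relation \<open>1\<close> by y + b and relation \<open>2\<close> by
      y + a makes the terms in y^P cancel in the difference.\<close>
    have "(a ^ ?P - b ^ ?P) * ((y + a) * (y + b))
        = ((y ^ ?P + a ^ ?P) * (y + a)) * (y + b) - ((y ^ ?P + b ^ ?P) * (y + b)) * (y + a)"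
      by (simp add: algebra_simps)
    also have "\<dots> = b - a"
      unfolding 1 2 by simp
    finally show "y \<in> {y. (y + a) * (y + b) = d}"
      using nz by (simp add: d_def field_simps)
  qed
  then have "card (translate_by_minus A a \<inter> translate_by_minus A b)
      \<le> card {y. (y + a) * (y + b) = d}"
    by (intro card_mono) auto
  then show ?thesis
    using card_shifted_product_eq_le_2 le_trans by blast
qed

text \<open>For each c in \<open>T\<close> the set S + c lies in S + T. Bounding one summand
  suffices: commutativity of the sum lets the other be treated by swapping \<open>S\<close> and
  \<open>T\<close>.\<close>

lemma card_summand_le_2:
  fixes S T :: "'a :: {field, finite} set"
  assumes small: "\<And>a b. a \<noteq> b \<Longrightarrow>
      card (translate_by_minus (S + T) a \<inter> translate_by_minus (S + T) b) \<le> 2"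
    and "card T \<ge> 2"
  shows "card S \<le> 2"
proof -
  obtain a b where ab: "a \<in> T" "b \<in> T" "a \<noteq> b"
    using \<open>card T \<ge> 2\<close> card_le_Suc0_iff_eq[of T] by auto
  have "S \<subseteq> translate_by_minus (S + T) c" if "c \<in> T" for c
    using that by (auto simp: mem_translate_by_minus_iff)
  with ab have "card S \<le> card (translate_by_minus (S + T) a \<inter> translate_by_minus (S + T) b)"
    by (intro card_mono) auto
  with small[OF \<open>a \<noteq> b\<close>] show ?thesis by simp
qed

lemma additively_irreducible_of_small_Int_translates:
  fixes A :: "'a :: {field, finite} set"
  assumes small: "\<And>a b. a \<noteq> b \<Longrightarrow>
      card (translate_by_minus A a \<inter> translate_by_minus A b) \<le> 2"
    and "card A > 4"
  shows "additively_irreducible A"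
  unfolding additively_irreducible_def
proof clarify
  fix S T :: "'a set"
  assume ST: "card S \<ge> 2" "card T \<ge> 2" "A = S + T"
  have "card S \<le> 2"
    using card_summand_le_2[of S T] small ST by simp
  moreover have "card T \<le> 2"
    using card_summand_le_2[of T S] small ST by (simp add: add.commute)
  moreover have "card (S + T) \<le> card S * card T"
    using card_image_le[of "S \<times> T" "\<lambda>(x, y). x + y"]
    by (simp add: set_plus_image card_cartesian_product)
  ultimately have "card A \<le> 2 * 2"
    unfolding ST(3) by (meson le_trans mult_le_mono)
  with \<open>card A > 4\<close> show False by simp
qed

theorem corollary1p6:
  fixes p q f k t e :: nat
    and A :: "('a :: {field, finite}) set"
  assumes "prime p"
    and "f \<ge> 1"
    and "q = p ^ f"
    and "CARD('a) = q"
    and "k dvd q - 1"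
    and "A = power_subgroup k"
    and "t = (q - 1) div k"
    and "t > 4"
    and "e \<ge> 1"
    and "[int p ^ e = -1] (mod int t)"
  shows "(\<forall>a b :: 'a. a \<noteq> b \<longrightarrow>
            card (translate_by_minus A a \<inter> translate_by_minus A b) \<le> 2) \<and>
         additively_irreducible A"
proof -
  \<comment> \<open>For k = 0 the convention that division by zero gives zero would make t =
    0.\<close>
  have "k > 0"
    using assms by (auto intro: gr0I)
  have "int t dvd int (p ^ e + 1)"
    using assms(10) by (simp add: cong_iff_dvd_diff add.commute)
  then obtain m where m: "p ^ e + 1 = t * m"
    using int_dvd_int_iff by blast
  have inv: "x ^ (p ^ e) * x = 1" if "x \<in> A" for x
  proof -
    obtain z where z: "z \<noteq> 0" "x = z ^ k"
      using \<open>x \<in> A\<close> assms(6) by (auto simp: power_subgroup_def)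
    \<comment> \<open>Since \<open>k\<close> divides q - 1, the division defining \<open>t\<close>
      is exact and k * t = q - 1.\<close>
    have "x ^ t = z ^ (q - 1)"
      using assms(5,7) z by (simp flip: power_mult)
    also have "\<dots> = 1"
      using power_card_minus_one[OF z(1)] assms(4) by simp
    finally have "x ^ (t * m) = 1"
      by (simp add: power_mult)
    then show ?thesis
      \<comment> \<open>The exponent t * m is p^e + 1, so this is the inversion relation.\<close>
      by (simp flip: m)
        (simp add: mult.commute)
  qed
  have "CHAR('a) = p"
    using CHAR_eq_of_CARD_eq_prime_power assms by blast
  from card_Int_translates_le_2[OF \<open>prime p\<close> this inv]
  have small: "card (translate_by_minus A a \<inter> translate_by_minus A b) \<le> 2" if "a \<noteq> b" for a b
    using that by blast
  moreover have "card A > 4"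
    using card_power_subgroup_ge[OF \<open>k > 0\<close>, where 'a = 'a] assms by simp
  ultimately show ?thesis
    using additively_irreducible_of_small_Int_translates by blast
qed

end
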